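(* Let $p$ be a prime and let $G$ be a finite abelian $p$-group with $|G| \ge p$. Then $\nu (G) = \nu_p (G) = \mathsf d (G)-1$.
   Context: For a finite abelian group $G$ (written additively) let $G^{\bullet} = G\setminus\{0\}$. A sequence over $G$ is a finite unordered sequence of elements of $G$ with repetition allowed (an element of the free abelian monoid with basis $G$, written multiplicatively; the empty sequence is allowed); $|T|$ is the length of $T$, and $\Sigma(T)$ is the set of all sums of nonempty subsequences of $T$. $T$ is zero-sum free if $0\notin\Sigma(T)$. $\mathsf d(G)$ is the maximal length of a zero-sum free sequence over $G$. For nontrivial $G$, $\nu(G)$ is the smallest integer $\ell\ge 0$ such that for every zero-sum free sequence $T$ over $G$ with $|T|\ge \ell$ there are a subgroup $H\subsetneq G$ and some $\alpha\in G\setminus H$ with $G^{\bullet}\setminus\Sigma(T)\subseteq\alpha+H$. For a prime divisor $p$ of $|G|$, $\nu_p(G)$ is the smallest integer $\ell\ge 0$ such that for every zero-sum free sequence $T$ over $G$ with $|T|\ge\ell$ there are a subgroup $H\subseteq G$ with index $(G:H)=p$ and some $\alpha\in G\setminus H$ with $G^{\bullet}\setminus\Sigma(T)\subseteq\alpha+H$. *)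

theory Defs
  imports "HOL-Algebra.Algebra" "HOL-Library.Multiset"
begin

text \<open>
  Groups are written multiplicatively, following HOL-Algebra: the neutral element \<open>\<one>\<^bsub>G\<^esub>\<close>
  plays the role of the paper's 0, \<open>\<otimes>\<^bsub>G\<^esub>\<close> that of addition, and the coset
  \<open>\<alpha> <#\<^bsub>G\<^esub> H\<close> is \<open>\<alpha> + H\<close>.  A sequence over \<open>G\<close> is a multiset \<open>T\<close> with
  \<open>set_mset T \<subseteq> carrier G\<close>; its length is \<open>size T\<close>.
\<close>

definition seq_sum :: "('a, 'b) monoid_scheme \<Rightarrow> 'a multiset \<Rightarrow> 'a" where
  "seq_sum G T = (\<Otimes>\<^bsub>G\<^esub>g\<in>set_mset T. g [^]\<^bsub>G\<^esub> count T g)"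

definition subsums :: "('a, 'b) monoid_scheme \<Rightarrow> 'a multiset \<Rightarrow> 'a set" where
  "subsums G T = {seq_sum G S | S. S \<subseteq># T \<and> S \<noteq> {#}}"

definition zero_sum_free :: "('a, 'b) monoid_scheme \<Rightarrow> 'a multiset \<Rightarrow> bool" where
  "zero_sum_free G T \<longleftrightarrow> set_mset T \<subseteq> carrier G \<and> \<one>\<^bsub>G\<^esub> \<notin> subsums G T"

text \<open>For finite \<open>G\<close> the lengths below are bounded, by \<open>card (carrier G) - 1\<close>, so the maximum exists.\<close>

definition small_davenport :: "('a, 'b) monoid_scheme \<Rightarrow> nat" where
  "small_davenport G = Max {size T | T. zero_sum_free G T}"

text \<open>
  The sets over which the two minima are taken contain every integer greater than
  \<open>small_davenport G\<close>, so they are nonempty.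
\<close>

definition nu :: "('a, 'b) monoid_scheme \<Rightarrow> nat" where
  "nu G = (LEAST l. \<forall>T. zero_sum_free G T \<and> l \<le> size T \<longrightarrow>
     (\<exists>H \<alpha>. subgroup H G \<and> H \<subset> carrier G \<and> \<alpha> \<in> carrier G - H \<and>
        (carrier G - {\<one>\<^bsub>G\<^esub>}) - subsums G T \<subseteq> \<alpha> <#\<^bsub>G\<^esub> H))"

definition nu_prime :: "nat \<Rightarrow> ('a, 'b) monoid_scheme \<Rightarrow> nat" where
  "nu_prime p G = (LEAST l. \<forall>T. zero_sum_free G T \<and> l \<le> size T \<longrightarrow>
     (\<exists>H \<alpha>. subgroup H G \<and> card (rcosets\<^bsub>G\<^esub> H) = p \<and> \<alpha> \<in> carrier G - H \<and>
        (carrier G - {\<one>\<^bsub>G\<^esub>}) - subsums G T \<subseteq> \<alpha> <#\<^bsub>G\<^esub> H))"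

end

theory Submission
  imports Defs
begin

text \<open>
  For a sequence \<open>T = g\<^sub>1 \<dots> g\<^sub>l\<close> expand \<open>F = (1 - X\<^sup>g\<^sup>1) \<dots> (1 - X\<^sup>g\<^sup>l)\<close> in the
  group algebra over the field with \<open>p\<close> elements; the coefficient of \<open>F\<close> at \<open>x \<noteq> 0\<close>
  vanishes unless \<open>x\<close> is a subsequence sum of \<open>T\<close>, and if \<open>T\<close> is zero-sum free, the
  coefficient at \<open>0\<close> is \<open>1\<close>.  As \<open>(1 - X\<^sup>e)\<^sup>q = 1 - X\<^sup>q\<^sup>e\<close> for powers \<open>q\<close> of \<open>p\<close>, an independent
  generating set \<open>E\<close> shows that such products with more than
  \<open>\<Sum>e\<in>E. ord e - 1\<close> factors are \<open>0\<close>, which is Olson's formula for \<open>d(G)\<close>.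

  If \<open>T\<close> is zero-sum free of length at least \<open>d(G) - 1\<close>, then \<open>(1 - X\<^sup>g) (1 - X\<^sup>h) F = 0\<close> for
  all \<open>g\<close> and \<open>h\<close>.  This says that \<open>g \<mapsto> F(g) - 1\<close> is a homomorphism to the integers mod
  \<open>p\<close>; it takes the value \<open>-1\<close> at every nonzero element that is not a sum, so these elements
  lie in one coset of its kernel.  Conversely, removing two terms \<open>g\<close>, \<open>h\<close> from a zero-sum
  free sequence of maximal length leaves \<open>-g\<close>, \<open>-h\<close> and \<open>-g-h\<close> without representation.

  An element of the group algebra is encoded below by an integer-valued function taken modulo
  \<open>p\<close>, and multiplication by \<open>1 - X\<^sup>g\<close> by a difference operator.  The operator uses
  \<open>f (g \<otimes> x)\<close> rather than \<open>f (inv g \<otimes> x)\<close>, so the coefficient of \<open>F\<close> at \<open>x\<close> is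
  the value at \<open>inv x\<close>.
\<close>

section \<open>Iterated differences modulo a prime\<close>

text \<open>Absorption makes \<open>p ^ k\<close> a divisor of \<open>j * (p ^ k choose j)\<close>;
  a binomial coefficient prime to \<open>p\<close> would force \<open>p ^ k\<close> to divide
  \<open>j\<close>.\<close>

lemma prime_power_dvd_binomial:
  fixes p k j :: nat
  assumes "Factorial_Ring.prime p" "0 < j" "j < p ^ k"
  shows "p dvd (p ^ k choose j)"
proof (rule ccontr)
  assume "\<not> p dvd (p ^ k choose j)"
  then have cop: "coprime (p ^ k) (p ^ k choose j)"
    using assms(1) by (simp add: prime_imp_coprime)
  have "p ^ k dvd j * (p ^ k choose j)"
    using binomial_absorption[of "j - 1" "p ^ k"] assms(2) by simp
  then have "p ^ k dvd j"
    using cop by (simp add: coprime_dvd_mult_left_iff)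
  then show False
    using assms(2,3) by (simp add: nat_dvd_not_less)
qed

context comm_group
begin

definition diff_op :: "'a \<Rightarrow> ('a \<Rightarrow> int) \<Rightarrow> 'a \<Rightarrow> int" where
  "diff_op g f = (\<lambda>x. f x - f (g \<otimes> x))"

abbreviation diffs :: "'a list \<Rightarrow> ('a \<Rightarrow> int) \<Rightarrow> 'a \<Rightarrow> int" where
  "diffs gs f \<equiv> foldr diff_op gs f"

lemma diffs_move:
  assumes "set us \<subseteq> carrier G" "g \<in> carrier G" "x \<in> carrier G"
  shows "diffs (us @ g # vs) f x = diffs (g # us @ vs) f x"
  using assms
proof (induction us arbitrary: x)
  case (Cons u us)
  then have "g \<otimes> (u \<otimes> x) = u \<otimes> (g \<otimes> x)"
    by (simp add: m_lcomm)
  with Cons show ?case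
    by (simp add: diff_op_def)
qed simp

lemma diffs_cong_mset:
  assumes "mset xs = mset ys" "set xs \<subseteq> carrier G" "x \<in> carrier G"
  shows "diffs xs f x = diffs ys f x"
  using assms
proof (induction xs arbitrary: ys x)
  case (Cons a xs)
  from Cons.prems(1) have "a \<in> set ys"
    by (metis list.set_intros(1) set_mset_mset)
  then obtain us vs where ys: "ys = us @ a # vs"
    by (meson split_list)
  with Cons.prems have "mset xs = mset (us @ vs)"
    by simp
  then have IH: "diffs xs f y = diffs (us @ vs) f y" if "y \<in> carrier G" for y
    using that Cons.prems(2) by (intro Cons.IH) auto
  have "set us \<subseteq> carrier G"
    using Cons.prems(1,2) ys by (metis Un_subset_iff mset_eq_setD set_append)
  then have "diffs ys f x = diffs (a # us @ vs) f x"
    using Cons.prems ys diffs_move by simp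
  also have "\<dots> = diffs (a # xs) f x"
    using Cons.prems IH by (simp add: diff_op_def)
  finally show ?case ..
qed simp

text \<open>The binomial theorem for two commuting operators, the identity and the translation by
  \<open>g\<close>.\<close>

lemma diffs_replicate:
  assumes "g \<in> carrier G" "x \<in> carrier G"
  shows "diffs (replicate n g) f x
    = (\<Sum>k\<le>n. (-1) ^ k * int (n choose k) * f (g [^] k \<otimes> x))"
  using assms(2)
proof (induction n arbitrary: x)
  case (Suc n)
  let ?h = "\<lambda>k::nat. f (g [^] k \<otimes> x)"
  have shift: "g [^] k \<otimes> (g \<otimes> x) = g [^] Suc k \<otimes> x" for k :: nat
    using assms(1) Suc.prems by (simp add: m_assoc)
  have "(\<Sum>k\<le>Suc n. (-1) ^ k * int (Suc n choose k) * ?h k)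
    = ?h 0 + (\<Sum>k\<le>n. (-1) ^ Suc k * int (n choose Suc k) * ?h (Suc k))
        + (\<Sum>k\<le>n. (-1) ^ Suc k * int (n choose k) * ?h (Suc k))"
    by (simp only: sum.atMost_Suc_shift binomial_Suc_Suc of_nat_add distrib_left
        distrib_right sum.distrib) simp
  also have "?h 0 + (\<Sum>k\<le>n. (-1) ^ Suc k * int (n choose Suc k) * ?h (Suc k))
    = (\<Sum>k\<le>Suc n. (-1) ^ k * int (n choose k) * ?h k)"
    by (simp only: sum.atMost_Suc_shift) simp
  also have "\<dots> = (\<Sum>k\<le>n. (-1) ^ k * int (n choose k) * ?h k)"
    by simp
  also have "(\<Sum>k\<le>n. (-1) ^ Suc k * int (n choose k) * ?h (Suc k))
    = - (\<Sum>k\<le>n. (-1) ^ k * int (n choose k) * f (g [^] k \<otimes> (g \<otimes> x)))"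
    by (simp add: shift sum_negf[symmetric] del: nat_pow_Suc)
  finally show ?case
    using Suc assms(1) by (simp add: diff_op_def)
qed simp

text \<open>The inner binomial coefficients vanish modulo \<open>p\<close>, and the two end terms
  cancel modulo \<open>p\<close> because they are evaluated at the same point.\<close>

lemma diffs_replicate_ord:
  assumes p: "Factorial_Ring.prime p" and g: "g \<in> carrier G" "ord g = p ^ k"
    and x: "x \<in> carrier G"
  shows "int p dvd diffs (replicate (ord g) g) f x"
proof -
  let ?q = "p ^ k"
  let ?t = "\<lambda>j. (-1) ^ j * int (?q choose j) * f (g [^] j \<otimes> x)"
  have q0: "?q > 0"
    using p by (simp add: prime_gt_0_nat)
  then have "{..?q} = insert 0 (insert ?q {0<..<?q})"
    by auto
  then have "diffs (replicate (ord g) g) f x = ?t 0 + ?t ?q + (\<Sum>j\<in>{0<..<?q}. ?t j)"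
    using g x q0 diffs_replicate by simp
  moreover have "int p dvd (\<Sum>j\<in>{0<..<?q}. ?t j)"
    by (intro dvd_sum dvd_mult2 dvd_mult) (simp add: prime_power_dvd_binomial[OF p])
  moreover have "int p dvd ?t 0 + ?t ?q"
  proof -
    have "g [^] ?q = \<one>"
      using g pow_ord_eq_1[OF g(1)] by simp
    then have eq: "?t 0 + ?t ?q = (1 + (-1) ^ ?q) * f x"
      using x by (simp add: distrib_right)
    \<comment> \<open>For odd \<open>?q\<close> this number is 0; an even \<open>?q\<close> forces
      \<open>p = 2\<close>, and the number is 2.\<close>
    have "int p dvd 1 + (-1) ^ ?q"
    proof (cases "even ?q")
      case True
      then have "even p"
        using even_power by blast
      then have "p = 2"
        using p by (metis primes_dvd_imp_eq two_is_prime_nat)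
      with True show ?thesis by simp
    qed simp
    then show ?thesis
      using eq by simp
  qed
  ultimately show ?thesis
    by simp
qed

text \<open>The periods of \<open>f\<close> modulo \<open>q\<close> form a subgroup.\<close>

lemma dvd_diff_op_generate:
  assumes E: "E \<subseteq> carrier G" "g \<in> generate G E"
    and d: "\<And>e x. e \<in> E \<Longrightarrow> x \<in> carrier G \<Longrightarrow> q dvd diff_op e f x"
    and x: "x \<in> carrier G"
  shows "q dvd diff_op g f x"
  using E(2) x
proof (induction arbitrary: x)
  case one
  then show ?case by (simp add: diff_op_def)
next
  case (incl h)
  then show ?case using d by simp
next
  case (inv h)
  then have h: "h \<in> carrier G" using E by auto
  with inv have "q dvd diff_op h f (inv h \<otimes> x)"
    using d by simp
  moreover have "h \<otimes> (inv h \<otimes> x) = x"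
    using h inv by (simp add: m_assoc[symmetric])
  ultimately show ?case
    by (simp add: diff_op_def dvd_diff_commute)
next
  case (eng h1 h2)
  then have h: "h1 \<in> carrier G" "h2 \<in> carrier G"
    using E(1) generate_in_carrier by auto
  then have "q dvd diff_op h2 f x + diff_op h1 f (h2 \<otimes> x)"
    using eng by (intro dvd_add) auto
  then show ?case
    using h eng.prems by (simp add: diff_op_def m_assoc)
qed

text \<open>Reduces the vanishing of all products of a given length to products of
  generators.\<close>

lemma dvd_diffs_generate:
  assumes E: "E \<subseteq> carrier G"
    and d: "\<And>vs f x. \<lbrakk>set vs \<subseteq> E; length vs = m; x \<in> carrier G\<rbrakk> \<Longrightarrow> q dvd diffs vs f x"
    and us: "set us \<subseteq> generate G E" "length us = m" and x: "x \<in> carrier G"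
  shows "q dvd diffs us f x"
proof -
  \<comment> \<open>Mixed products make the induction work: with all other entries fixed, one entry
    from \<open>generate G E\<close> is traded for entries from \<open>E\<close> by the period
    argument.\<close>
  have "q dvd diffs (us @ vs) f x"
    if "set us \<subseteq> generate G E" "set vs \<subseteq> E" "length us + length vs = m" "x \<in> carrier G"
    for us vs x
    using that
  proof (induction us arbitrary: vs x)
    case Nil
    then show ?case using d by simp
  next
    case (Cons u us)
    have us: "set us \<subseteq> carrier G"
      using Cons.prems E generate_in_carrier by auto
    have "q dvd diff_op e (diffs (us @ vs) f) y" if "e \<in> E" "y \<in> carrier G" for e y
    proof -
      have "q dvd diffs (us @ e # vs) f y"
        using Cons.IH[of "e # vs" y] Cons.prems that by simp
      then show ?thesis
        using diffs_move[OF us, of e y vs f] that E by auto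
    qed
    then show ?case
      using dvd_diff_op_generate[OF E, of u] Cons.prems by simp
  qed
  from this[of us "[]"] us x show ?thesis by simp
qed


text \<open>For entries from \<open>E\<close>, the pigeonhole principle gives a generator
  \<open>e\<close> that occurs at least \<open>ord e\<close> times, and \<open>ord e\<close> copies
  of it already yield 0 modulo \<open>p\<close>.\<close>

lemma dvd_diffs_long:
  assumes fin: "finite (carrier G)" and p: "Factorial_Ring.prime p" "order G = p ^ n"
    and E: "E \<subseteq> carrier G" "generate G E = carrier G"
    and gs: "set gs \<subseteq> carrier G" "length gs > (\<Sum>e\<in>E. ord e - 1)"
    and x: "x \<in> carrier G"
  shows "int p dvd diffs gs f x"
proof (rule dvd_diffs_generate[OF E(1), where m = "length gs"])
  fix vs f y
  assume vs: "set vs \<subseteq> E" "length vs = length gs" and y: "y \<in> carrier G"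
  have finE: "finite E"
    using E(1) fin finite_subset by blast
  have "\<exists>e\<in>E. ord e \<le> count (mset vs) e"
  proof (rule ccontr)
    assume "\<not> ?thesis"
    then have "(\<Sum>e\<in>E. count (mset vs) e) \<le> (\<Sum>e\<in>E. ord e - 1)"
      by (intro sum_mono) fastforce
    moreover have "(\<Sum>e\<in>E. count (mset vs) e) = length vs"
      using vs(1) finE by (simp add: size_multiset_overloaded_eq flip: size_mset)
        (intro sum.mono_neutral_right, auto simp: not_in_iff)
    ultimately show False
      using vs(2) gs(2) by simp
  qed
  then obtain e where e: "e \<in> E" "ord e \<le> count (mset vs) e"
    by blast
  then have "replicate_mset (ord e) e \<subseteq># mset vs"
    by (simp add: count_le_replicate_mset_subset_eq)
  then obtain R where R: "mset vs = replicate_mset (ord e) e + R"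
    by (auto simp: subset_mset.le_iff_add)
  obtain rs where "R = mset rs"
    by (metis ex_mset)
  with R have perm: "mset vs = mset (replicate (ord e) e @ rs)"
    by simp
  have "ord e dvd p ^ n"
    using ord_dvd_group_order[of e] e(1) E(1) p(2) by auto
  then obtain k where "ord e = p ^ k"
    using p(1) divides_primepow_nat by blast
  then have "int p dvd diffs (replicate (ord e) e) (diffs rs f) y"
    using diffs_replicate_ord p(1) e(1) E(1) y by blast
  then show "int p dvd diffs vs f y"
    using diffs_cong_mset[OF perm, of y f] vs(1) E(1) y by auto
qed (use E gs x in auto)

section \<open>Independent generators of a finite abelian p-group\<close>

lemma finprod_nat_pow:
  assumes "f \<in> A \<rightarrow> carrier G"
  shows "(\<Otimes>x\<in>A. f x [^] (k::nat)) = (\<Otimes>x\<in>A. f x) [^] k"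
  using assms
proof (induction A rule: infinite_finite_induct)
  case (insert x A)
  then show ?case
    by (simp add: nat_pow_distrib Pi_def)
qed auto

text \<open>
  If the generating set had a nontrivial relation, dividing its exponents by their largest
  common power of \<open>p\<close> would give an element that can replace one of the generators
  and has smaller order.
\<close>

lemma exists_independent_generators:
  assumes fin: "finite (carrier G)" and p: "Factorial_Ring.prime p" "order G = p ^ n"
  obtains E where "E \<subseteq> carrier G" "generate G E = carrier G"
    "\<And>a :: 'a \<Rightarrow> nat. (\<Otimes>e\<in>E. e [^] a e) = \<one> \<Longrightarrow> \<forall>e\<in>E. ord e dvd a e"
proof -
  let ?gen = "\<lambda>E. E \<subseteq> carrier G \<and> generate G E = carrier G"
  let ?w = "\<lambda>E. \<Sum>e\<in>E. ord e"
  have "?gen (carrier G)"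
    using generate_incl[of "carrier G"] by (auto intro: generate.incl)
  \<comment> \<open>The sum of the orders is the measure that an exchange of generators would
    decrease.\<close>
  then obtain E where E: "?gen E" and min: "\<And>E'. ?gen E' \<Longrightarrow> ?w E \<le> ?w E'"
    using ex_has_least_nat[of ?gen "carrier G" ?w] by metis
  have finE: "finite E"
    using E fin finite_subset by blast
  have "\<forall>e\<in>E. ord e dvd a e" if rel: "(\<Otimes>e\<in>E. e [^] a e) = \<one>" for a :: "'a \<Rightarrow> nat"
  proof (rule ccontr)
    define B where "B = {e \<in> E. \<not> ord e dvd a e}"
    assume "\<not> (\<forall>e\<in>E. ord e dvd a e)"
    then have "B \<noteq> {}"
      by (auto simp: B_def)
    have B: "B \<subseteq> E" "finite B" "B \<subseteq> carrier G"
      using finE E by (auto simp: B_def)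
    have apos: "a e > 0" if "e \<in> B" for e
      using that by (cases "a e") (auto simp: B_def)
    obtain j where j: "j \<in> B" and jmin: "\<And>e. e \<in> B \<Longrightarrow> multiplicity p (a j) \<le> multiplicity p (a e)"
      using ex_min_if_finite[of "(\<lambda>e. multiplicity p (a e)) ` B"] B(2) \<open>B \<noteq> {}\<close>
      by (auto simp: not_less)
    \<comment> \<open>By the choice of \<open>j\<close>, \<open>p ^ k\<close> divides every exponent
      on \<open>B\<close>, and the quotient \<open>b j\<close> is prime to \<open>p\<close>.\<close>
    define k where "k = multiplicity p (a j)"
    define b where "b e = a e div p ^ k" for e
    have ab: "a e = b e * p ^ k" if "e \<in> B" for e
      using jmin[OF that] multiplicity_dvd'[of k p "a e"] by (simp add: b_def k_def)
    have "\<not> p dvd b j"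
      using multiplicity_decompose[of "a j" p] apos[OF j] p(1)
      by (simp add: b_def k_def prime_nat_iff)
    then have cop: "coprime (b j) (p ^ n)"
      using p(1) by (simp add: coprime_commute prime_imp_coprime)
    define e' where "e' = (\<Otimes>e\<in>B. e [^] b e)"
    have e': "e' \<in> carrier G"
      unfolding e'_def using B by (intro finprod_closed) auto
    \<comment> \<open>This power of \<open>e'\<close> is the given relation again, since the terms
      outside \<open>B\<close> are trivial.\<close>
    have "e' [^] (p ^ k) = (\<Otimes>e\<in>B. e [^] a e)"
      unfolding e'_def using B
      by (subst finprod_nat_pow[symmetric]) (auto intro!: finprod_cong' simp: ab nat_pow_pow)
    also have "\<dots> = (\<Otimes>e\<in>E. e [^] a e)"
      using B finE E by (intro finprod_mono_neutral_cong_left) (auto simp: B_def pow_eq_id)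
    finally have "ord e' dvd p ^ k"
      using rel e' by (simp add: pow_eq_id)
    then have le: "ord e' \<le> p ^ k"
      using p(1) by (simp add: dvd_imp_le prime_gt_0_nat)
    have jc: "j \<in> carrier G"
      using j B by blast
    then have ordj: "ord j dvd p ^ n"
      using ord_dvd_group_order[of j] p(2) by simp
    then obtain s where s: "ord j = p ^ s"
      using p(1) divides_primepow_nat by blast
    have "k < s"
    proof (rule ccontr)
      assume "\<not> k < s"
      then have "ord j dvd a j"
        using s ab[OF j] by (simp add: le_imp_power_dvd)
      then show False
        using j by (simp add: B_def)
    qed
    then have "p ^ k < ord j"
      using s prime_gt_1_nat[OF p(1)] by simp
    define E' where "E' = insert e' (E - {j})"
    have E'c: "E' \<subseteq> carrier G"
      using E e' by (auto simp: E'_def)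
    interpret K: subgroup "generate G E'" G
      using E'c by (rule generate_is_subgroup)
    have powK: "x [^] i \<in> generate G E'" if "x \<in> generate G E'" for x and i :: nat
      using that by (induction i) simp_all
    have incl: "e \<in> generate G E'" if "e \<in> E'" for e
      using that by (rule generate.incl)
    \<comment> \<open>Solving the definition of \<open>e'\<close> for \<open>j [^] b j\<close> puts
      this power into the subgroup; as \<open>b j\<close> is invertible modulo \<open>ord j\<close>,
      a further power is \<open>j\<close> itself.\<close>
    have "j \<in> generate G E'"
    proof -
      let ?r = "\<Otimes>e\<in>B - {j}. e [^] b e"
      have "finite F \<Longrightarrow> F \<subseteq> E' \<Longrightarrow> (\<Otimes>e\<in>F. e [^] b e) \<in> generate G E'" for F
      proof (induction F rule: finite_induct)
        case (insert x F)
        then show ?case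
          using E'c incl powK
          by (subst finprod_insert) (auto simp: Pi_def)
      qed simp
      then have r: "?r \<in> generate G E'"
        using B by (auto simp: E'_def)
      have "e' = j [^] b j \<otimes> ?r"
        unfolding e'_def using B j
        by (subst finprod_insert[symmetric]) (auto simp: insert_absorb)
      then have "j [^] b j = e' \<otimes> inv ?r"
        using jc r K.subset e' inv_solve_right[of "j [^] b j" e' ?r] by auto
      then have "j [^] b j \<in> generate G E'"
        using r K.m_closed[OF incl[of e'] K.m_inv_closed[OF r]] by (simp add: E'_def)
      moreover have "coprime (b j) (ord j)"
        using cop ordj coprime_divisors[of "b j" "b j" "ord j" "p ^ n"] by simp
      then obtain c y where c: "b j * c = ord j * y + 1"
        using bezout_nat[of "b j" "ord j"] \<open>\<not> p dvd b j\<close>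
        by (cases "b j = 0") (auto simp: coprime_iff_gcd_eq_1)
      have "(j [^] b j) [^] c = (j [^] ord j) [^] y \<otimes> j"
        using jc by (simp add: nat_pow_pow c del: pow_ord_eq_1)
      then have "(j [^] b j) [^] c = j"
        using jc by simp
      ultimately show ?thesis
        using powK[of "j [^] b j" c] by simp
    qed
    then have "E \<subseteq> generate G E'"
      using incl by (auto simp: E'_def)
    then have "carrier G \<subseteq> generate G E'"
      using E generate_subgroup_incl[OF _ K.subgroup_axioms, of E] by simp
    then have "?gen E'"
      using E'c K.subset by auto
    then have "?w E \<le> ?w E'"
      by (rule min)
    \<comment> \<open>Only an inequality, as \<open>e'\<close> may already lie in
      \<open>E - {j}\<close>.\<close>
    also have "\<dots> \<le> ord e' + ?w (E - {j})"
      using finE by (simp add: E'_def sum.insert_if)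
    also have "\<dots> < ord j + ?w (E - {j})"
      using le \<open>p ^ k < ord j\<close> by simp
    also have "\<dots> = ?w E"
      using finE j B(1) by (simp add: sum.remove[symmetric] subset_iff)
    finally show False by simp
  qed
  then show thesis
    using that E by blast
qed

section \<open>Subsequence sums and coefficients of the product\<close>

lemma seq_sum_superset:
  assumes "finite A" "A \<subseteq> carrier G" "set_mset S \<subseteq> A"
  shows "seq_sum G S = (\<Otimes>g\<in>A. g [^] count S g)"
  unfolding seq_sum_def using assms
  by (intro finprod_mono_neutral_cong_left) (auto simp: not_in_iff)

lemma seq_sum_empty [simp]: "seq_sum G {#} = \<one>"
  by (simp add: seq_sum_def)

lemma seq_sum_add_mset:
  assumes "set_mset S \<subseteq> carrier G" "g \<in> carrier G"
  shows "seq_sum G (add_mset g S) = g \<otimes> seq_sum G S"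
proof -
  let ?A = "insert g (set_mset S)"
  have A: "finite ?A" "?A \<subseteq> carrier G"
    using assms by auto
  have "seq_sum G (add_mset g S) = (\<Otimes>h\<in>?A. (if g = h then h else \<one>) \<otimes> h [^] count S h)"
    unfolding seq_sum_superset[OF A, of "add_mset g S", simplified] using A
    by (intro finprod_cong') (auto simp: m_comm)
  also have "\<dots> = (\<Otimes>h\<in>?A. if g = h then h else \<one>) \<otimes> (\<Otimes>h\<in>?A. h [^] count S h)"
    using A by (intro finprod_multf) auto
  also have "(\<Otimes>h\<in>?A. if g = h then h else \<one>) = g"
    using A finprod_singleton[of g ?A "\<lambda>h. h"] by auto
  also have "(\<Otimes>h\<in>?A. h [^] count S h) = seq_sum G S"
    using A by (intro seq_sum_superset[symmetric]) auto
  finally show ?thesis .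
qed

lemma seq_sum_closed [simp]: "set_mset S \<subseteq> carrier G \<Longrightarrow> seq_sum G S \<in> carrier G"
  by (induction S) (simp_all add: seq_sum_add_mset)

text \<open>The unit of the group algebra, so that \<open>diffs ts delta\<close> encodes the product
  F.\<close>

abbreviation delta :: "'a \<Rightarrow> int" where
  "delta \<equiv> \<lambda>x. if x = \<one> then 1 else 0"

lemma subset_add_msetI: "S \<subseteq># T \<Longrightarrow> S \<subseteq># add_mset t T"
  by (auto simp: subseteq_mset_def intro: le_SucI)

text \<open>The value at \<open>x\<close> is a signed count of the subsequences with sum
  \<open>inv x\<close>; the induction splits them by whether they use the first term.\<close>

lemma diffs_delta_eq_0:
  assumes "set ts \<subseteq> carrier G" "x \<in> carrier G"
    and "\<And>S. S \<subseteq># mset ts \<Longrightarrow> seq_sum G S \<otimes> x \<noteq> \<one>"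
  shows "diffs ts delta x = 0"
  using assms
proof (induction ts arbitrary: x)
  case Nil
  from Nil.prems(3)[of "{#}"] Nil.prems(2) show ?case by simp
next
  case (Cons t ts)
  have "diffs ts delta x = 0"
    using Cons.prems subset_add_msetI[of _ "mset ts" t] by (intro Cons.IH) auto
  moreover have "diffs ts delta (t \<otimes> x) = 0"
  proof (rule Cons.IH)
    fix S assume S: "S \<subseteq># mset ts"
    then have "set_mset S \<subseteq> carrier G"
      using Cons.prems(1) set_mset_mono[OF S] by auto
    then have "seq_sum G S \<otimes> (t \<otimes> x) = seq_sum G (add_mset t S) \<otimes> x"
      using Cons.prems(1,2) by (simp add: seq_sum_add_mset m_lcomm m_assoc)
    then show "seq_sum G S \<otimes> (t \<otimes> x) \<noteq> \<one>"
      using Cons.prems(3)[of "add_mset t S"] S by simp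
  qed (use Cons.prems in auto)
  ultimately show ?case
    using diff_op_def[of t "diffs ts delta"] by simp
qed

text \<open>Only the empty subsequence contributes: a contribution using the first term
  \<open>t\<close> would be a nonempty subsequence with trivial sum.\<close>

lemma diffs_delta_one:
  assumes "zero_sum_free G (mset ts)"
  shows "diffs ts delta \<one> = 1"
  using assms
proof (induction ts)
  case (Cons t ts)
  have t: "t \<in> carrier G" "set ts \<subseteq> carrier G"
    using Cons.prems by (auto simp: zero_sum_free_def)
  have free: "seq_sum G S \<noteq> \<one>" if "S \<subseteq># add_mset t (mset ts)" "S \<noteq> {#}" for S
    using Cons.prems that by (force simp: zero_sum_free_def subsums_def)
  have "zero_sum_free G (mset ts)"
    using t free subset_add_msetI[of _ "mset ts" t]
    by (force simp: zero_sum_free_def subsums_def)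
  moreover have "diffs ts delta t = 0"
  proof (rule diffs_delta_eq_0)
    fix S assume S: "S \<subseteq># mset ts"
    then have "set_mset S \<subseteq> carrier G"
      using t set_mset_mono[OF S] by auto
    then show "seq_sum G S \<otimes> t \<noteq> \<one>"
      using free[of "add_mset t S"] S t by (simp add: seq_sum_add_mset m_comm)
  qed (use t in auto)
  ultimately show ?case
    using Cons.IH t diff_op_def[of t "diffs ts delta"] by simp
qed simp


section \<open>Olson's formula for the Davenport constant\<close>

text \<open>The three facts rest on one choice of \<open>E\<close>. Taking each generator
  \<open>e\<close> exactly \<open>ord e - 1\<close> times gives a zero-sum free sequence by
  independence; for a longer zero-sum free one the product would vanish modulo \<open>p\<close>,
  although its value at \<open>\<one>\<close> is 1.\<close>

lemma p_group_davenport: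
  assumes fin: "finite (carrier G)" and p: "Factorial_Ring.prime p" "order G = p ^ n"
  shows small_davenport_attained: "\<exists>M. zero_sum_free G M \<and> size M = small_davenport G"
    and size_le_small_davenport: "zero_sum_free G T \<Longrightarrow> size T \<le> small_davenport G"
    and dvd_diffs_small_davenport:
      "\<lbrakk>set gs \<subseteq> carrier G; small_davenport G < length gs; x \<in> carrier G\<rbrakk>
        \<Longrightarrow> int p dvd diffs gs f x"
proof -
  obtain E where E: "E \<subseteq> carrier G" "generate G E = carrier G"
    and indep: "\<And>a :: 'a \<Rightarrow> nat. (\<Otimes>e\<in>E. e [^] a e) = \<one> \<Longrightarrow> \<forall>e\<in>E. ord e dvd a e"
    using exists_independent_generators[OF fin p] by blast
  have finE: "finite E"
    using E(1) fin finite_subset by blast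
  let ?d = "\<Sum>e\<in>E. ord e - 1"
  note vanish = dvd_diffs_long[OF fin p E]
  define M where "M = (\<Sum>e\<in>E. replicate_mset (ord e - 1) e)"
  have cM: "count M g = (if g \<in> E then ord g - 1 else 0)" for g
    using finE by (simp add: M_def count_sum)
  have setM: "set_mset M \<subseteq> E"
    by (auto simp: cM split: if_splits simp flip: count_greater_zero_iff)
  have size_M: "size M = ?d"
    by (simp add: M_def)
  have M: "zero_sum_free G M"
    unfolding zero_sum_free_def subsums_def
  proof safe
    fix g assume "g \<in># M"
    then show "g \<in> carrier G" using setM E(1) by blast
  next
    fix S assume S: "\<one> = seq_sum G S" "S \<subseteq># M" "S \<noteq> {#}"
    have setS: "set_mset S \<subseteq> E"
      using setM set_mset_mono[OF S(2)] by blast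
    then have dvd: "\<forall>e\<in>E. ord e dvd count S e"
      using S(1) seq_sum_superset[OF finE E(1)] indep[of "count S"] by simp
    obtain e where e: "e \<in># S"
      using S(3) by blast
    then have "ord e \<le> count S e"
      using dvd setS by (intro dvd_imp_le) auto
    also have "\<dots> \<le> ord e - 1"
      using mset_subset_eq_count[OF S(2), of e] e setS cM by auto
    finally show False
      using ord_ge_1[OF fin, of e] e setS E(1) by auto
  qed
  have le: "size T \<le> ?d" if "zero_sum_free G T" for T
  proof (rule ccontr)
    assume "\<not> size T \<le> ?d"
    moreover obtain ts where ts: "mset ts = T"
      using ex_mset by blast
    ultimately have "int p dvd diffs ts delta \<one>"
      using that vanish[of ts \<one> delta]
      by (auto simp: zero_sum_free_def not_le simp flip: size_mset)
    then have "int p dvd 1"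
      using diffs_delta_one that ts by metis
    then show False
      using prime_gt_1_nat[OF p(1)] by simp
  qed
  have d: "small_davenport G = ?d"
    unfolding small_davenport_def
  proof (rule Max_eqI)
    show "finite {size T |T. zero_sum_free G T}"
      by (rule finite_subset[of _ "{..?d}"]) (use le in blast, simp)
    show "?d \<in> {size T |T. zero_sum_free G T}"
      using M size_M by (metis (mono_tags, lifting) mem_Collect_eq)
  qed (use le in blast)
  show "\<exists>M. zero_sum_free G M \<and> size M = small_davenport G"
    using M size_M d by metis
  show "zero_sum_free G T \<Longrightarrow> size T \<le> small_davenport G"
    unfolding d by (rule le)
  show "\<lbrakk>set gs \<subseteq> carrier G; small_davenport G < length gs; x \<in> carrier G\<rbrakk>
        \<Longrightarrow> int p dvd diffs gs f x"
    unfolding d by (rule vanish)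
qed

section \<open>Long sequences: the missing elements lie in one coset\<close>

lemma missing_sums_in_coset:
  assumes fin: "finite (carrier G)" and p: "Factorial_Ring.prime p" "order G = p ^ n" "n > 0"
    and T: "zero_sum_free G T" "small_davenport G \<le> size T + 1"
  shows "\<exists>H \<alpha>. subgroup H G \<and> card (rcosets H) = p \<and> \<alpha> \<in> carrier G - H \<and>
        (carrier G - {\<one>}) - subsums G T \<subseteq> \<alpha> <# H"
proof (cases "(carrier G - {\<one>}) - subsums G T = {}")
  \<comment> \<open>With nothing missing, any subgroup of index \<open>p\<close> serves, and Sylow's
    theorem supplies one.\<close>
  case True
  have p1: "p > 1"
    using prime_gt_1_nat[OF p(1)] .
  have ord: "order G = p ^ (n - 1) * p"
    using p(2,3) by (metis power_minus_mult)
  obtain H where H: "subgroup H G" "card H = p ^ (n - 1)"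
    using sylow_thm[OF p(1) is_group ord fin] by blast
  then have "card (rcosets H) = p"
    using lagrange[OF H(1)] ord p1 by simp
  moreover have "card H < order G"
    using H(2) ord p1 by simp
  then have "carrier G - H \<noteq> {}"
    using subgroup.subset[OF H(1)] by (auto simp: order_def)
  ultimately show ?thesis
    using H(1) True by blast
next
  case False
  then obtain \<alpha> where \<alpha>: "\<alpha> \<in> carrier G" "\<alpha> \<noteq> \<one>" "\<alpha> \<notin> subsums G T"
    by blast
  obtain ts where ts: "mset ts = T"
    using ex_mset by blast
  have tsc: "set ts \<subseteq> carrier G"
    using T(1) ts by (auto simp: zero_sum_free_def)
  define F where "F = diffs ts delta"
  have F1: "F \<one> = 1"
    using diffs_delta_one T(1) ts by (simp add: F_def)
  have miss: "F (inv x) = 0" if x: "x \<in> carrier G" "x \<noteq> \<one>" "x \<notin> subsums G T" for x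
    unfolding F_def
  proof (rule diffs_delta_eq_0[OF tsc])
    fix S assume S: "S \<subseteq># mset ts"
    then have "set_mset S \<subseteq> carrier G"
      using tsc set_mset_mono[OF S] by auto
    moreover have "seq_sum G S \<noteq> x"
      using S x ts by (cases "S = {#}") (auto simp: subsums_def)
    ultimately show "seq_sum G S \<otimes> inv x \<noteq> \<one>"
      using x(1) by (metis inv_closed inv_inv inv_equality seq_sum_closed)
  qed (use x in simp)
  \<comment> \<open>The inverse turns values of \<open>F\<close> back into coefficients; subtracting
    1 normalizes \<phi> to 0 at \<open>\<one>\<close>.\<close>
  define \<phi> where "\<phi> g = (F (inv g) - 1) mod int p" for g
  have p1: "int p > 1"
    using prime_gt_1_nat[OF p(1)] by simp
  have hom: "\<phi> (g \<otimes> h) = (\<phi> g + \<phi> h) mod int p" if gh: "g \<in> carrier G" "h \<in> carrier G" for g h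
  proof -
    \<comment> \<open>At this point the second difference involves only \<open>F\<close> at
      \<open>?y\<close>, \<open>inv g\<close>, \<open>inv h\<close> and \<open>\<one>\<close>, so
      its vanishing becomes additivity of \<phi>.\<close>
    let ?y = "inv (g \<otimes> h)"
    have y: "h \<otimes> ?y = inv g" "g \<otimes> ?y = inv h" "h \<otimes> inv h = \<one>"
      using gh m_lcomm[of h "inv g" "inv h"] m_assoc[of g "inv g" "inv h"]
      by (simp_all add: inv_mult)
    have "small_davenport G < length (g # h # ts)"
      using T(2) ts by (auto simp flip: size_mset)
    then have "int p dvd diffs (g # h # ts) delta ?y"
      using gh tsc by (intro dvd_diffs_small_davenport[OF fin p(1,2)]) auto
    also have "diffs (g # h # ts) delta ?y = diff_op g (diff_op h F) ?y"
      by (simp add: F_def)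
    also have "\<dots> = (F ?y - 1) - ((F (inv g) - 1) + (F (inv h) - 1))"
      unfolding diff_op_def y by (simp add: F1)
    finally have "(F ?y - 1) mod int p = ((F (inv g) - 1) + (F (inv h) - 1)) mod int p"
      by (simp add: mod_eq_dvd_iff)
    then show ?thesis
      by (simp add: \<phi>_def mod_add_eq)
  qed
  have range: "\<phi> g \<in> {0..<int p}" for g
    using p1 by (simp add: \<phi>_def)
  have cancel: "\<phi> g = 0 \<longleftrightarrow> \<phi> (g \<otimes> h) = \<phi> h" if "g \<in> carrier G" "h \<in> carrier G" for g h
  proof -
    have "\<phi> (g \<otimes> h) = \<phi> h \<longleftrightarrow> (\<phi> g + \<phi> h) mod int p = \<phi> h mod int p"
      using hom[OF that] range[of h] by simp
    also have "\<dots> \<longleftrightarrow> int p dvd \<phi> g"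
      by (simp add: mod_eq_dvd_iff)
    also have "\<dots> \<longleftrightarrow> \<phi> g = 0"
      using range[of g] by (auto dest: zdvd_imp_le)
    finally show ?thesis ..
  qed
  define H where "H = {g \<in> carrier G. \<phi> g = 0}"
  have one: "\<phi> \<one> = 0"
    by (simp add: \<phi>_def F1)
  have H: "subgroup H G"
  proof (rule subgroupI)
    fix a assume a: "a \<in> H"
    then show "inv a \<in> H"
      using cancel[of "inv a" a] one by (simp add: H_def)
    fix b assume "b \<in> H"
    with a show "a \<otimes> b \<in> H"
      using cancel[of a b] by (simp add: H_def)
  qed (use one in \<open>auto simp: H_def\<close>)
  have \<phi>_miss: "\<phi> x = (- 1) mod int p" if "x \<in> carrier G" "x \<noteq> \<one>" "x \<notin> subsums G T" for x
    using miss[OF that] by (simp add: \<phi>_def)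
  have "\<phi> \<alpha> \<noteq> 0"
    using \<phi>_miss[OF \<alpha>] p1 by (simp add: zmod_minus1)
  then have \<alpha>H: "\<alpha> \<in> carrier G - H"
    using \<alpha>(1) by (simp add: H_def)
  have coset: "H #> a = {x \<in> carrier G. \<phi> x = \<phi> a}" if a: "a \<in> carrier G" for a
  proof (intro equalityI subsetI)
    fix x assume "x \<in> H #> a"
    then show "x \<in> {x \<in> carrier G. \<phi> x = \<phi> a}"
      using a cancel by (auto simp: r_coset_def H_def)
  next
    fix x assume x: "x \<in> {x \<in> carrier G. \<phi> x = \<phi> a}"
    then have eq: "x = (x \<otimes> inv a) \<otimes> a"
      using a by (simp add: m_assoc)
    then have "x \<otimes> inv a \<in> H"
      using a x cancel[of "x \<otimes> inv a" a] by (simp add: H_def)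
    then show "x \<in> H #> a"
      using eq unfolding r_coset_def by blast
  qed
  \<comment> \<open>The cosets are the fibres of \<phi>, which has at most \<open>p\<close> values.
    By Lagrange the index is a power of \<open>p\<close>, and it exceeds 1 because \<alpha> is
    outside \<open>H\<close>; hence it equals \<open>p\<close>.\<close>
  have "rcosets H = (\<lambda>v. {x \<in> carrier G. \<phi> x = v}) ` \<phi> ` carrier G"
    using coset by (auto simp: RCOSETS_def)
  moreover have "card ((\<lambda>v. {x \<in> carrier G. \<phi> x = v}) ` \<phi> ` carrier G) \<le> card (\<phi> ` carrier G)"
    using fin by (intro card_image_le) auto
  moreover have "card (\<phi> ` carrier G) \<le> card {0..<int p}"
    using range by (intro card_mono) auto
  ultimately have le: "card (rcosets H) \<le> p"
    by simp
  have lag: "card (rcosets H) * card H = p ^ n"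
    using lagrange[OF H] p(2) by simp
  then obtain j where j: "card (rcosets H) = p ^ j"
    using p(1) divides_primepow_nat by (metis dvd_triv_left)
  have "card H < p ^ n"
    using \<alpha>H subgroup.subset[OF H] fin p(2) psubset_card_mono[of "carrier G" H]
    by (auto simp: order_def)
  then have "j \<noteq> 0"
    using lag j by (metis mult_1 order_less_irrefl power_0)
  then have "card (rcosets H) = p"
    using le j p1 power_increasing_iff[of p j 1] by (cases "j = 1") auto
  moreover have "(carrier G - {\<one>}) - subsums G T \<subseteq> \<alpha> <# H"
  proof
    fix x assume "x \<in> (carrier G - {\<one>}) - subsums G T"
    then have x: "x \<in> carrier G" "\<phi> x = \<phi> \<alpha>"
      using \<phi>_miss \<alpha> by auto
    have "inv \<alpha> \<otimes> x \<in> H"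
      using cancel[of "inv \<alpha> \<otimes> x" \<alpha>] x \<alpha>(1)
      by (simp add: H_def m_comm[of _ \<alpha>] m_assoc[symmetric])
    moreover have "x = \<alpha> \<otimes> (inv \<alpha> \<otimes> x)"
      using x(1) \<alpha>(1) by (simp add: m_assoc[symmetric])
    ultimately show "x \<in> \<alpha> <# H"
      unfolding l_coset_def by blast
  qed
  ultimately show ?thesis
    using H \<alpha>H by blast
qed

section \<open>Removing two terms from a zero-sum free sequence\<close>

lemma zero_sum_free_subset:
  assumes "zero_sum_free G T" "S \<subseteq># T"
  shows "zero_sum_free G S"
proof -
  have "subsums G S \<subseteq> subsums G T"
    using subset_mset.order_trans[OF _ assms(2)] unfolding subsums_def by blast
  then show ?thesis
    using assms(1) set_mset_mono[OF assms(2)] unfolding zero_sum_free_def by blast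
qed

text \<open>A subsequence of \<open>T\<close> with this sum, joined to \<open>R\<close>, would have
  trivial sum.\<close>

lemma inv_notin_subsums:
  assumes "zero_sum_free G (R + T)" "R \<noteq> {#}"
  shows "inv (seq_sum G R) \<notin> subsums G T"
proof
  have c: "set_mset R \<subseteq> carrier G" "set_mset T \<subseteq> carrier G"
    using assms(1) by (auto simp: zero_sum_free_def)
  assume "inv (seq_sum G R) \<in> subsums G T"
  then obtain S where S: "S \<subseteq># T" "seq_sum G S = inv (seq_sum G R)"
    by (auto simp: subsums_def)
  have cS: "set_mset S \<subseteq> carrier G"
    using c(2) set_mset_mono[OF S(1)] by blast
  have "seq_sum G (R + S) = seq_sum G R \<otimes> seq_sum G S"
    using c(1) cS by (induction R) (auto simp: seq_sum_add_mset m_assoc)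
  then have "seq_sum G (R + S) = \<one>"
    using S(2) c by simp
  moreover have "R + S \<subseteq># R + T" "R + S \<noteq> {#}"
    using S(1) assms(2) by auto
  ultimately show False
    using assms(1) unfolding zero_sum_free_def subsums_def by (metis (mono_tags, lifting) mem_Collect_eq)
qed

text \<open>
  The inverses of \<open>g\<close>, \<open>h\<close> and \<open>g \<otimes> h\<close> are all missing from the sums, and no coset of a proper
  subgroup other than the subgroup itself contains two elements together with their product.
\<close>

lemma missing_sums_not_in_coset:
  assumes M: "zero_sum_free G (add_mset g (add_mset h T))"
    and H: "subgroup H G" "\<alpha> \<in> carrier G - H"
  shows "\<not> (carrier G - {\<one>}) - subsums G T \<subseteq> \<alpha> <# H"
proof
  assume sub: "(carrier G - {\<one>}) - subsums G T \<subseteq> \<alpha> <# H"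
  \<comment> \<open>To be applied to the three nonempty subsequences of the removed pair.\<close>
  have missing: "inv (seq_sum G R) \<in> \<alpha> <# H" if R: "R \<subseteq># {#g, h#}" "R \<noteq> {#}" for R
  proof -
    have RT: "R + T \<subseteq># add_mset g (add_mset h T)"
      using R(1) by (metis subset_mset.add_right_mono union_mset_add_mset_left
          add.left_neutral)
    then have zsf: "zero_sum_free G (R + T)"
      using M zero_sum_free_subset by blast
    moreover have "zero_sum_free G R"
      using zero_sum_free_subset[OF zsf] by simp
    then have "set_mset R \<subseteq> carrier G" "seq_sum G R \<noteq> \<one>"
      using R(2) by (force simp: zero_sum_free_def subsums_def)+
    ultimately show ?thesis
      using inv_notin_subsums[OF zsf R(2)] sub by auto
  qed
  have gh: "g \<in> carrier G" "h \<in> carrier G"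
    using M by (auto simp: zero_sum_free_def)
  have "inv g \<in> \<alpha> <# H" "inv h \<in> \<alpha> <# H" "inv (g \<otimes> h) \<in> \<alpha> <# H"
    using missing[of "{#g#}"] missing[of "{#h#}"] missing[of "{#g, h#}"] gh
    by (simp_all add: seq_sum_add_mset)
  then obtain a b c where abc: "a \<in> H" "b \<in> H" "c \<in> H"
    "inv g = \<alpha> \<otimes> a" "inv h = \<alpha> \<otimes> b" "inv (g \<otimes> h) = \<alpha> \<otimes> c"
    unfolding l_coset_def by blast
  have car: "a \<in> carrier G" "b \<in> carrier G" "c \<in> carrier G" "\<alpha> \<in> carrier G"
    using abc H subgroup.subset by blast+
  \<comment> \<open>Comparing representatives and cancelling one factor \<alpha> expresses the other
    one through elements of \<open>H\<close>.\<close>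
  have "\<alpha> \<otimes> c = inv g \<otimes> inv h"
    using abc(6) gh by (simp add: inv_mult)
  also have "\<dots> = \<alpha> \<otimes> (a \<otimes> (\<alpha> \<otimes> b))"
    unfolding abc(4,5) using car by (simp add: m_assoc)
  finally have "c = a \<otimes> (\<alpha> \<otimes> b)"
    using car by simp
  then have "c = \<alpha> \<otimes> (a \<otimes> b)"
    using car by (simp add: m_lcomm)
  then have "\<alpha> = c \<otimes> inv (a \<otimes> b)"
    using car by (simp add: inv_solve_right)
  then have "\<alpha> \<in> H"
    using abc subgroup.m_closed[OF H(1)] subgroup.m_inv_closed[OF H(1)] by simp
  then show False
    using H(2) by simp
qed

end

section \<open>Evaluation of both minima\<close>

theorem theorem3p5:
  fixes G :: "('a, 'b) monoid_scheme" and p n :: nat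
  assumes "comm_group G"
    and "finite (carrier G)"
    and "Factorial_Ring.prime p"
    and "card (carrier G) = p ^ n"
    and "card (carrier G) \<ge> p"
  shows "nu G = nu_prime p G \<and> int (nu_prime p G) = int (small_davenport G) - 1"
proof -
  interpret comm_group G by fact
  let ?d = "small_davenport G"
  let ?miss = "\<lambda>T. (carrier G - {\<one>\<^bsub>G\<^esub>}) - subsums G T"
  let ?N = "\<lambda>l. \<forall>T. zero_sum_free G T \<and> l \<le> size T \<longrightarrow>
    (\<exists>H \<alpha>. subgroup H G \<and> H \<subset> carrier G \<and> \<alpha> \<in> carrier G - H \<and> ?miss T \<subseteq> \<alpha> <#\<^bsub>G\<^esub> H)"
  let ?Np = "\<lambda>l. \<forall>T. zero_sum_free G T \<and> l \<le> size T \<longrightarrow>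
    (\<exists>H \<alpha>. subgroup H G \<and> card (rcosets\<^bsub>G\<^esub> H) = p \<and> \<alpha> \<in> carrier G - H \<and> ?miss T \<subseteq> \<alpha> <#\<^bsub>G\<^esub> H)"
  have ord: "order G = p ^ n"
    using assms(4) by (simp add: order_def)
  have p1: "p > 1"
    using prime_gt_1_nat[OF assms(3)] .
  have n: "n > 0"
    using assms(4,5) p1 by (cases n) auto
  note dav = p_group_davenport[OF assms(2,3) ord]
  have Np: "?Np (?d - 1)"
    by (intro allI impI missing_sums_in_coset[OF assms(2,3) ord n]) auto
  have N_of_Np: "?N l" if Np: "?Np l" for l
  proof (intro allI impI)
    fix T assume "zero_sum_free G T \<and> l \<le> size T"
    then obtain H \<alpha> where "subgroup H G" "\<alpha> \<in> carrier G - H" "?miss T \<subseteq> \<alpha> <#\<^bsub>G\<^esub> H"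
      using Np by metis
    moreover from this have "H \<subset> carrier G"
      using subgroup.subset[of H G] by auto
    ultimately show "\<exists>H \<alpha>. subgroup H G \<and> H \<subset> carrier G \<and> \<alpha> \<in> carrier G - H \<and> ?miss T \<subseteq> \<alpha> <#\<^bsub>G\<^esub> H"
      by metis
  qed
  \<comment> \<open>Proved for the weaker property \<open>?N\<close>, the bound serves both minima
    through \<open>N_of_Np\<close>.\<close>
  have lower: "?d - 1 \<le> l" if N: "?N l" for l
  proof (rule ccontr)
    assume "\<not> ?d - 1 \<le> l"
    then have l: "l + 2 \<le> ?d"
      by simp
    \<comment> \<open>A maximal sequence without two of its terms still has length at least
      \<open>l\<close>.\<close>
    obtain M where M: "zero_sum_free G M" "size M = ?d"
      using dav(1) by blast
    then obtain g M' where M': "M = add_mset g M'"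
      using l by (cases M) auto
    then obtain h T where T: "M = add_mset g (add_mset h T)"
      using l M(2) by (cases M') auto
    then have "zero_sum_free G T"
      by (intro zero_sum_free_subset[OF M(1)]) (simp add: subset_add_msetI)
    moreover have "l \<le> size T"
      using T l M(2) by simp
    ultimately obtain H \<alpha> where "subgroup H G" "\<alpha> \<in> carrier G - H" "?miss T \<subseteq> \<alpha> <#\<^bsub>G\<^esub> H"
      using N by metis
    then show False
      using missing_sums_not_in_coset M(1) T by metis
  qed
  have "nu_prime p G = ?d - 1"
    unfolding nu_prime_def by (rule Least_equality, rule Np, rule lower[OF N_of_Np])
  moreover have "nu G = ?d - 1"
    unfolding nu_def by (rule Least_equality, rule N_of_Np[OF Np], rule lower)
  \<comment> \<open>The minima were found with truncated subtraction, while the claim subtracts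
    integers; a single nontrivial element shows that both agree.\<close>
  moreover have "?d \<ge> 1"
  proof -
    have "carrier G \<noteq> {\<one>\<^bsub>G\<^esub>}"
      using assms(5) p1 by auto
    then obtain g where g: "g \<in> carrier G" "g \<noteq> \<one>\<^bsub>G\<^esub>"
      by blast
    have "S = {#g#}" if "S \<subseteq># {#g#}" "S \<noteq> {#}" for S
      using that by (auto simp: subset_mset.le_iff_add single_is_union)
    then have "subsums G {#g#} \<subseteq> {seq_sum G {#g#}}"
      unfolding subsums_def by blast
    then have "zero_sum_free G {#g#}"
      using g by (auto simp: zero_sum_free_def seq_sum_add_mset)
    then have "size {#g#} \<le> ?d"
      by (rule dav(2))
    then show ?thesis
      by simp
  qed
  ultimately show ?thesis
    by simp
qed

end
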